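(* Let $f \in \mathbb{C}[x]$ have degree $d \geq 2$, let $n \geq 1$, let $f^{\circ n}$ denote the $n$th iterate of $f$, and let $p\in\mathbb{C}$ be a point that is not a critical value of $f^{\circ n}$. Let $R_n = \{x \in \mathbb{C} : f^{\circ n}(x) = p\}$ and $R_1=\{x\in\mathbb{C} : f(x)=p\}$, and let the monodromy group $MG_n(f)$ of $f^{\circ n}$ act naturally on $R_n$. Suppose that either $d$ is prime or the monodromy group $MG(f)$ acts primitively on $R_1$. If $E \subseteq R_n$ is any set containing elements $a, b$ such that $f^{\circ (n-1)}(a) \neq f^{\circ (n-1)}(b)$, then the smallest $MG_n(f)$-block of $R_n$ containing $E$ is $R_n$ itself.
   Context: For a polynomial $F \in \mathbb{C}[x]$ of degree $D\ge 1$ with finite set of critical values $\mathcal V$ (images under $F$ of its critical points), $F$ restricts to a covering $\mathbb{C}\setminus F^{-1}(\mathcal V)\to\mathbb{C}\setminus \mathcal V$. For $p \in \mathbb{C}\setminus \mathcal V$ (a generic point), path lifting of closed loops at $p$ in $\mathbb{C}\setminus \mathcal V$ gives an action of $\pi_1(\mathbb{C}\setminus \mathcal V,p)$ on the $D$ points of $F^{-1}(p)$; the resulting group of permutations of $F^{-1}(p)$ is the monodromy group $MG(F)$ of $F$ (independent of $p$ up to relabeling). We write $MG_n(f) = MG(f^{\circ n})$, acting on $R_n=(f^{\circ n})^{-1}(p)$; $f^{\circ 0}$ is the identity. Let a group $G$ act on a finite set $S$. A subset $E\subseteq S$ is a $G$-block if for every $\sigma\in G$ the set $\sigma(E)\cap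 E$ is equal to either $E$ or $\emptyset$. The action is primitive if the only (nonempty) $G$-blocks are single points and all of $S$. *)

theory Defs
  imports "HOL-Analysis.Analysis" "HOL-Algebra.Group_Action"
    "HOL-Computational_Algebra.Polynomial"
begin

subsection \<open>Iterates, fibres and critical values\<close>

definition poly_iter :: "nat \<Rightarrow> 'a::comm_semiring_1 poly \<Rightarrow> 'a poly" where
  "poly_iter n f = ((\<lambda>g. pcompose f g) ^^ n) [:0, 1:]"

lemma poly_poly_iter: "poly (poly_iter n f) x = (poly f ^^ n) x"
  by (induction n) (simp_all add: poly_iter_def poly_pcompose)

definition fibre :: "complex poly \<Rightarrow> complex \<Rightarrow> complex set" where
  "fibre F p = {x. poly F x = p}"

definition critical_values :: "complex poly \<Rightarrow> complex set" where
  "critical_values F = poly F ` {z. poly (pderiv F) z = 0}"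


subsection \<open>The monodromy group\<close>

definition monodromy_loops :: "complex poly \<Rightarrow> complex \<Rightarrow> (real \<Rightarrow> complex) set" where
  "monodromy_loops F p =
     {\<gamma>. path \<gamma> \<and> path_image \<gamma> \<subseteq> - critical_values F \<and> pathstart \<gamma> = p \<and> pathfinish \<gamma> = p}"

definition is_lift :: "complex poly \<Rightarrow> (real \<Rightarrow> complex) \<Rightarrow> (real \<Rightarrow> complex) \<Rightarrow> bool" where
  "is_lift F \<gamma> h \<longleftrightarrow> path h \<and> (\<forall>t\<in>{0..1}. poly F (h t) = \<gamma> t)"

text \<open>
  For nonconstant \<open>F\<close>, a path avoiding the critical values of \<open>F\<close> has exactly one lift
  (up to its values outside the unit interval) starting at a given point of the fibre over its
  starting point, so the definite description below denotes the endpoint of that lift.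
\<close>

definition lift_end :: "complex poly \<Rightarrow> (real \<Rightarrow> complex) \<Rightarrow> complex \<Rightarrow> complex" where
  "lift_end F \<gamma> x = (THE y. \<exists>h. is_lift F \<gamma> h \<and> pathstart h = x \<and> pathfinish h = y)"

definition monodromy_perm ::
    "complex poly \<Rightarrow> complex \<Rightarrow> (real \<Rightarrow> complex) \<Rightarrow> complex \<Rightarrow> complex" where
  "monodromy_perm F p \<gamma> = (\<lambda>x\<in>fibre F p. lift_end F \<gamma> x)"

text \<open>
  The permutation induced by a loop only depends on its homotopy class, so ranging over loops
  gives the image of the fundamental group in the group of permutations of the fibre.
\<close>

definition monodromy_group :: "complex poly \<Rightarrow> complex \<Rightarrow> (complex \<Rightarrow> complex) monoid" where
  "monodromy_group F p =
     (BijGroup (fibre F p))\<lparr>carrier := monodromy_perm F p ` monodromy_loops F p\<rparr>"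


subsection \<open>Blocks and primitivity\<close>

text \<open>
  As in \<^theory>\<open>HOL-Algebra.Group_Action\<close>, \<open>\<phi>\<close> sends a group element to the permutation of the
  set \<open>S\<close> by which it acts.
\<close>

definition is_block ::
    "('g, 'm) monoid_scheme \<Rightarrow> 's set \<Rightarrow> ('g \<Rightarrow> 's \<Rightarrow> 's) \<Rightarrow> 's set \<Rightarrow> bool" where
  "is_block G S \<phi> B \<longleftrightarrow>
     B \<subseteq> S \<and> (\<forall>\<sigma>\<in>carrier G. \<phi> \<sigma> ` B \<inter> B = B \<or> \<phi> \<sigma> ` B \<inter> B = {})"

definition is_smallest_block ::
    "('g, 'm) monoid_scheme \<Rightarrow> 's set \<Rightarrow> ('g \<Rightarrow> 's \<Rightarrow> 's) \<Rightarrow> 's set \<Rightarrow> 's set \<Rightarrow> bool" where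
  "is_smallest_block G S \<phi> E B \<longleftrightarrow>
     is_block G S \<phi> B \<and> E \<subseteq> B \<and> (\<forall>B'. is_block G S \<phi> B' \<and> E \<subseteq> B' \<longrightarrow> B \<subseteq> B')"

definition primitive_action ::
    "('g, 'm) monoid_scheme \<Rightarrow> 's set \<Rightarrow> ('g \<Rightarrow> 's \<Rightarrow> 's) \<Rightarrow> bool" where
  "primitive_action G S \<phi> \<longleftrightarrow>
     (\<forall>B. is_block G S \<phi> B \<and> B \<noteq> {} \<longrightarrow> (\<exists>x. B = {x}) \<or> B = S)"

end

theory Submission
  imports Defs "HOL-Complex_Analysis.Conformal_Mappings"
    "HOL-Computational_Algebra.Fundamental_Theorem_Algebra" "HOL-Number_Theory.Cong"
begin

text \<open>
  Write \<open>F = f \<circ> G\<close> with \<open>G\<close> the \<open>(n - 1)\<close>-st iterate, so that \<open>G\<close> maps \<open>R\<^sub>n\<close> onto \<open>R\<^sub>1\<close>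
  equivariantly. A loop around infinity acts on \<open>R\<^sub>n\<close> as a single cycle \<open>s\<close> of length \<open>d ^ n\<close>, lying
  over a single cycle \<open>t\<close> of length \<open>d\<close> on \<open>R\<^sub>1\<close>. If \<open>a\<close> and \<open>s ^ k a\<close> lie in a block \<open>B\<close>, then \<open>s ^ k\<close>
  preserves \<open>B\<close>; so \<open>B\<close> is everything as soon as some such \<open>k\<close> is coprime to \<open>d\<close>. For prime \<open>d\<close> the
  point \<open>b\<close> provides \<open>k\<close>, because \<open>G a \<noteq> G b\<close> says that \<open>d\<close> does not divide it. Otherwise \<open>G ` B\<close>
  is a block of \<open>MG f\<close>: if a loop takes \<open>G x\<close> to \<open>G y\<close> with \<open>x, y \<in> B\<close>, then its lift to \<open>R\<^sub>n\<close>
  followed by a power of \<open>s\<close> that is trivial on \<open>R\<^sub>1\<close> takes \<open>x\<close> to \<open>y\<close>, hence preserves \<open>B\<close>. By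
  primitivity \<open>G ` B = R\<^sub>1\<close>, so \<open>t (G a) \<in> G ` B\<close>, which gives an exponent congruent to 1 modulo \<open>d\<close>.
  A loop avoiding only the critical values of \<open>f\<close> has first to be moved off those of \<open>F\<close>.
\<close>

subsection \<open>Polynomials as covering maps\<close>

lemma degree_poly_iter: "degree (poly_iter n f) = degree f ^ n"
  for f :: "complex poly"
  by (induction n) (simp_all add: poly_iter_def degree_pcompose)

lemma poly_iter_Suc: "poly_iter (Suc n) f = pcompose f (poly_iter n f)"
  by (simp add: poly_iter_def)

lemma degree_diff_const: "degree (F - [:w:]) = degree F"
  for F :: "complex poly"
proof (cases "degree F = 0")
  case True
  then show ?thesis
    by (auto elim: degree_eq_zeroE)
next
  case False
  then show ?thesis
    using degree_add_eq_left[of "- [:w:]" F] by (simp del: minus_pCons)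
qed

lemma poly_surj_complex:
  fixes F :: "complex poly"
  assumes "degree F \<ge> 1"
  obtains z where "poly F z = w"
proof -
  have "\<not> constant (poly (F - [:w:]))"
    using assms by (subst constant_degree) (simp add: degree_diff_const)
  then obtain z where "poly (F - [:w:]) z = 0"
    using fundamental_theorem_of_algebra by blast
  then show ?thesis
    by (intro that[of z]) simp
qed

lemma finite_critical_values:
  assumes "degree F \<ge> 1"
  shows "finite (critical_values F)"
  unfolding critical_values_def
  using assms by (intro finite_imageI poly_roots_finite) (auto simp: pderiv_eq_0_iff)

text \<open>By the chain rule, any \<open>G\<close>-preimage of a critical point of \<open>F\<close>
  is critical for the composite, and \<open>G\<close> is onto. Hence loops admissible for the
  composite are admissible for \<open>F\<close>.\<close>

lemma critical_values_pcompose: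
  assumes "degree G \<ge> 1"
  shows "critical_values F \<subseteq> critical_values (pcompose F G)"
proof
  fix v assume "v \<in> critical_values F"
  then obtain z where z: "poly (pderiv F) z = 0" "v = poly F z"
    by (auto simp: critical_values_def)
  obtain w where w: "poly G w = z"
    using poly_surj_complex[OF assms] by metis
  show "v \<in> critical_values (pcompose F G)"
    unfolding critical_values_def
    by (rule image_eqI[of _ _ w]) (use z w in \<open>auto simp: poly_pcompose pderiv_pcompose\<close>)
qed

lemma finite_fibre:
  assumes "degree F \<ge> 1"
  shows "finite (fibre F p)"
proof -
  have "F - [:p:] \<noteq> 0"
    using assms by auto
  then have "finite {x. poly (F - [:p:]) x = 0}"
    by (rule poly_roots_finite)
  then show ?thesis
    by (simp add: fibre_def)
qed

text \<open>No root of \<open>F - [:p:]\<close> is a critical point, so this polynomial is a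
  constant times a product of distinct linear factors, and degrees can be compared.\<close>

lemma card_fibre:
  assumes "degree F \<ge> 1" "p \<notin> critical_values F"
  shows "card (fibre F p) = degree F"
proof -
  let ?P = "F - [:p:]"
  have deg: "degree ?P = degree F"
    using assms by (simp add: degree_diff_const)
  have nz: "lead_coeff ?P \<noteq> 0"
    using assms deg by (metis degree_0 leading_coeff_0_iff not_one_le_zero)
  have "rsquarefree ?P"
    using assms(2) by (auto simp: rsquarefree_roots critical_values_def pderiv_diff)
  then have "smult (lead_coeff ?P) (\<Prod>z|poly ?P z = 0. [:-z, 1:]) = ?P"
    by (rule complex_poly_decompose_rsquarefree)
  then have "degree (\<Prod>z|poly ?P z = 0. [:-z, 1:]) = degree ?P"
    using nz by (metis degree_smult_eq)
  moreover have "degree (\<Prod>z|poly ?P z = 0. [:-z, 1:]) = card {z. poly ?P z = 0}"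
    by (subst degree_prod_sum_eq) auto
  ultimately show ?thesis
    using deg by (simp add: fibre_def)
qed

text \<open>A nonzero derivative makes \<open>F\<close> injective near each preimage of a regular
  value, which yields the sheets. That there are no further ones follows by counting, since all
  regular fibres have the same size.\<close>

lemma covering_space_poly:
  assumes deg: "degree F \<ge> 1"
  shows "covering_space (- (poly F -` critical_values F)) (poly F) (- critical_values F)"
proof
  let ?V = "critical_values F"
  show "continuous_on (- (poly F -` ?V)) (poly F)"
    by (intro continuous_intros)
  show "poly F ` (- (poly F -` ?V)) = - ?V"
  proof
    show "- ?V \<subseteq> poly F ` (- (poly F -` ?V))"
    proof
      fix w assume "w \<in> - ?V"
      moreover obtain z where "poly F z = w"
        using poly_surj_complex[OF deg] by metis
      ultimately show "w \<in> poly F ` (- (poly F -` ?V))"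
        by auto
    qed
  qed auto
  have open_V: "open (- ?V)"
    using finite_critical_values[OF deg] by (simp add: finite_imp_closed open_Compl)
  fix y assume y: "y \<in> - ?V"
  define S where "S = fibre F y"
  have fin: "finite S" and card: "card S = degree F"
    using finite_fibre[OF deg] card_fibre[OF deg] y by (auto simp: S_def)
  have "\<exists>r>0. inj_on (poly F) (ball x r)" if "x \<in> S" for x
  proof (rule has_complex_derivative_locally_injective[of "poly F" UNIV x])
    show "deriv (poly F) x \<noteq> 0"
      using y that by (auto simp: poly_DERIV[THEN DERIV_imp_deriv] critical_values_def S_def fibre_def)
  qed (auto intro: holomorphic_intros)
  then obtain r where r: "\<And>x. x \<in> S \<Longrightarrow> r x > 0 \<and> inj_on (poly F) (ball x (r x))"
    by metis
  have "\<exists>e>0. \<forall>x'\<in>S. x' \<noteq> x \<longrightarrow> e \<le> dist x x'" for x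
    using finite_set_avoid[OF fin] by metis
  then obtain e where e: "\<And>x. e x > 0 \<and> (\<forall>x'\<in>S. x' \<noteq> x \<longrightarrow> e x \<le> dist x x')"
    by metis
  \<comment> \<open>Half the distance to the nearest other preimage keeps the balls
    disjoint.\<close>
  define W where "W = (\<lambda>x. ball x (min (r x) (e x / 2)))"
  have W_open: "open (W x)" for x
    by (simp add: W_def)
  have W_mem: "x \<in> W x" if "x \<in> S" for x
    using r e that by (simp add: W_def)
  have W_inj: "inj_on (poly F) (W x)" if "x \<in> S" for x
    using r[OF that] by (auto simp: W_def intro: inj_on_subset)
  have W_disj: "x = x'" if "x \<in> S" "x' \<in> S" "z \<in> W x" "z \<in> W x'" for x x' z
  proof (rule ccontr)
    assume "x \<noteq> x'"
    then have "e x \<le> dist x x'" "e x' \<le> dist x x'"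
      using e that by (metis, metis dist_commute)
    moreover have "dist x z < e x / 2" "dist x' z < e x' / 2"
      using that by (auto simp: W_def)
    ultimately show False
      using dist_triangle2[of x x' z] by linarith
  qed
  \<comment> \<open>The intersection is finite, so it stays open; removing \<open>?V\<close> makes
    \<open>card_fibre\<close> available over every point of \<open>T\<close>.\<close>
  define T where "T = (\<Inter>x\<in>S. poly F ` W x) \<inter> - ?V"
  have T_open: "open T"
    unfolding T_def
    by (intro open_Int open_V open_INT fin ballI invariance_of_domain W_open W_inj)
       (auto intro: continuous_intros)
  have yT: "y \<in> T"
    using y W_mem by (force simp: T_def S_def fibre_def)
  define U where "U = (\<lambda>x. W x \<inter> poly F -` T)"
  have U_open: "open (U x)" for x
    unfolding U_def by (intro open_Int W_open open_vimage T_open continuous_intros)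
  have U_image: "poly F ` U x = T" if x: "x \<in> S" for x
  proof
    show "T \<subseteq> poly F ` U x"
    proof
      fix w assume "w \<in> T"
      moreover from this obtain z where "z \<in> W x" "w = poly F z"
        using x by (auto simp: T_def)
      ultimately show "w \<in> poly F ` U x"
        by (auto simp: U_def)
    qed
  qed (auto simp: U_def)
  \<comment> \<open>Each \<open>W x\<close> already contains a preimage of every point of \<open>T\<close>; since all regular fibres have
    \<open>degree F\<close> points, there are no others.\<close>
  have cover: "\<exists>x\<in>S. z \<in> W x" if z: "poly F z \<in> T" for z
  proof -
    have "\<forall>x\<in>S. \<exists>w\<in>W x. poly F w = poly F z"
      using z by (force simp: T_def)
    then obtain w where w: "\<And>x. x \<in> S \<Longrightarrow> w x \<in> W x \<and> poly F (w x) = poly F z"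
      by metis
    have "inj_on w S"
      by (rule inj_onI) (metis W_disj w)
    then have "card (w ` S) = card (fibre F (poly F z))"
      using card card_fibre[OF deg] z by (simp add: card_image T_def)
    moreover have "w ` S \<subseteq> fibre F (poly F z)"
      using w by (auto simp: fibre_def)
    ultimately have "w ` S = fibre F (poly F z)"
      by (intro card_subset_eq finite_fibre deg)
    then have "z \<in> w ` S"
      by (simp add: fibre_def)
    then show ?thesis
      using w by auto
  qed
  show "\<exists>T. y \<in> T \<and> openin (top_of_set (- ?V)) T \<and>
          (\<exists>v. \<Union>v = - (poly F -` ?V) \<inter> poly F -` T \<and>
            (\<forall>u\<in>v. openin (top_of_set (- (poly F -` ?V))) u) \<and> pairwise disjnt v \<and>
            (\<forall>u\<in>v. Ex (homeomorphism u T (poly F))))"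
  proof (intro exI conjI)
    show "y \<in> T" by fact
    show "openin (top_of_set (- ?V)) T"
      by (intro openin_open_eq[THEN iffD2] conjI open_V T_open) (auto simp: T_def)
    show "\<Union> (U ` S) = - (poly F -` ?V) \<inter> poly F -` T"
      using cover by (auto simp: U_def T_def)
    show "\<forall>u\<in>U ` S. openin (top_of_set (- (poly F -` ?V))) u"
      by (auto intro!: open_subset U_open) (auto simp: U_def T_def)
    show "pairwise disjnt (U ` S)"
      using W_disj by (auto simp: pairwise_def disjnt_def U_def)
    show "\<forall>u\<in>U ` S. Ex (homeomorphism u T (poly F))"
    proof clarify
      fix x assume x: "x \<in> S"
      obtain g where "homeomorphism (U x) (poly F ` U x) (poly F) g"
      proof (rule invariance_of_domain_homeomorphism[OF U_open])
        show "inj_on (poly F) (U x)"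
          using W_inj[OF x] by (auto simp: U_def intro: inj_on_subset)
      qed (auto intro: continuous_intros)
      then show "Ex (homeomorphism (U x) T (poly F))"
        using U_image[OF x] by metis
    qed
  qed
qed

subsection \<open>Lifting paths\<close>

lemma is_lift_exists:
  assumes "degree F \<ge> 1" "path \<gamma>" "path_image \<gamma> \<subseteq> - critical_values F"
    and "x \<in> fibre F (pathstart \<gamma>)"
  obtains h where "is_lift F \<gamma> h" "pathstart h = x"
proof (rule covering_space_lift_path_strong[OF covering_space_poly[OF assms(1)] _ assms(2,3)])
  show "x \<in> - (poly F -` critical_values F)"
    using assms by (auto simp: fibre_def)
  show "pathstart \<gamma> = poly F x"
    using assms by (simp add: fibre_def)
  fix h assume "path h" "pathstart h = x" "\<And>t. t \<in> {0..1} \<Longrightarrow> poly F (h t) = \<gamma> t"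
  then show thesis
    by (intro that[of h]) (simp_all add: is_lift_def)
qed

lemma is_lift_path_image:
  assumes "path_image \<gamma> \<subseteq> - critical_values F" "is_lift F \<gamma> h"
  shows "path_image h \<subseteq> - (poly F -` critical_values F)"
  using assms by (auto simp: path_image_def is_lift_def)

text \<open>This is the monodromy theorem. The case of equal paths gives the uniqueness that the
  definite description in \<open>lift_end\<close> relies on.\<close>

lemma is_lift_pathfinish_homotopic:
  assumes "degree F \<ge> 1" "homotopic_paths (- critical_values F) \<gamma> \<gamma>'"
    and "is_lift F \<gamma> h" "is_lift F \<gamma>' h'" "pathstart h = pathstart h'"
  shows "pathfinish h = pathfinish h'"
  using covering_space_monodromy[OF covering_space_poly[OF assms(1)] _ _ _ _ assms(2), of h h']
    homotopic_paths_imp_subset[OF assms(2)] homotopic_paths_imp_path[OF assms(2)]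
    is_lift_path_image assms unfolding is_lift_def by metis

lemma lift_end_eqI:
  assumes "degree F \<ge> 1" "path_image \<gamma> \<subseteq> - critical_values F"
    and "is_lift F \<gamma> h" "pathstart h = x" "path \<gamma>"
  shows "lift_end F \<gamma> x = pathfinish h"
  unfolding lift_end_def
proof (rule the_equality)
  fix y assume "\<exists>h. is_lift F \<gamma> h \<and> pathstart h = x \<and> pathfinish h = y"
  then show "y = pathfinish h"
    using is_lift_pathfinish_homotopic assms homotopic_paths_refl by metis
qed (use assms in auto)

lemma lift_end_homotopic:
  assumes "degree F \<ge> 1" "homotopic_paths (- critical_values F) \<gamma> \<gamma>'"
    and "x \<in> fibre F (pathstart \<gamma>)"
  shows "lift_end F \<gamma> x = lift_end F \<gamma>' x"
proof -
  have "x \<in> fibre F (pathstart \<gamma>')"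
    using assms homotopic_paths_imp_pathstart by metis
  then obtain h h' where "is_lift F \<gamma> h" "pathstart h = x" "is_lift F \<gamma>' h'" "pathstart h' = x"
    using assms is_lift_exists homotopic_paths_imp_subset homotopic_paths_imp_path by metis
  then show ?thesis
    using assms is_lift_pathfinish_homotopic lift_end_eqI homotopic_paths_imp_subset
      homotopic_paths_imp_path by metis
qed

lemma lift_end_fibre:
  assumes "degree F \<ge> 1" "path \<gamma>" "path_image \<gamma> \<subseteq> - critical_values F"
    and "x \<in> fibre F (pathstart \<gamma>)"
  shows "lift_end F \<gamma> x \<in> fibre F (pathfinish \<gamma>)"
proof -
  obtain h where h: "is_lift F \<gamma> h" "pathstart h = x"
    using assms is_lift_exists by metis
  then have "poly F (h 1) = \<gamma> 1"
    by (simp add: is_lift_def)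
  then show ?thesis
    using h assms lift_end_eqI by (auto simp: fibre_def pathfinish_def)
qed

lemma lift_end_joinpaths:
  assumes "degree F \<ge> 1" "path \<gamma>" "path_image \<gamma> \<subseteq> - critical_values F"
    and "path \<delta>" "path_image \<delta> \<subseteq> - critical_values F" "pathfinish \<gamma> = pathstart \<delta>"
    and "x \<in> fibre F (pathstart \<gamma>)"
  shows "lift_end F (\<gamma> +++ \<delta>) x = lift_end F \<delta> (lift_end F \<gamma> x)"
proof -
  obtain h where h: "is_lift F \<gamma> h" "pathstart h = x"
    using assms is_lift_exists by metis
  moreover have "lift_end F \<gamma> x \<in> fibre F (pathstart \<delta>)"
    using assms lift_end_fibre by metis
  then obtain k where k: "is_lift F \<delta> k" "pathstart k = lift_end F \<gamma> x"
    using assms is_lift_exists by metis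
  moreover have hk: "pathfinish h = pathstart k"
    using h k assms lift_end_eqI by metis
  ultimately have "is_lift F (\<gamma> +++ \<delta>) (h +++ k)"
    by (auto simp: is_lift_def) (auto simp: joinpaths_def)
  then have "lift_end F (\<gamma> +++ \<delta>) x = pathfinish (h +++ k)"
    using assms h(2) by (intro lift_end_eqI) (auto simp: path_image_join)
  also have "\<dots> = lift_end F \<delta> (lift_end F \<gamma> x)"
    using k assms lift_end_eqI by simp
  finally show ?thesis .
qed

lemma lift_end_reversepath:
  assumes "degree F \<ge> 1" "path \<gamma>" "path_image \<gamma> \<subseteq> - critical_values F"
    and "x \<in> fibre F (pathstart \<gamma>)"
  shows "lift_end F (reversepath \<gamma>) (lift_end F \<gamma> x) = x"
proof -
  obtain h where h: "is_lift F \<gamma> h" "pathstart h = x"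
    using assms is_lift_exists by metis
  then have "is_lift F (reversepath \<gamma>) (reversepath h)"
    by (auto simp: is_lift_def) (auto simp: reversepath_def)
  then have "lift_end F (reversepath \<gamma>) (lift_end F \<gamma> x) = pathfinish (reversepath h)"
    using assms h lift_end_eqI by (intro lift_end_eqI) auto
  then show ?thesis
    using h by simp
qed

lemma inj_on_lift_end:
  assumes "degree F \<ge> 1" "path \<gamma>" "path_image \<gamma> \<subseteq> - critical_values F"
  shows "inj_on (lift_end F \<gamma>) (fibre F (pathstart \<gamma>))"
  by (rule inj_on_inverseI) (rule lift_end_reversepath[OF assms])

text \<open>If \<open>h\<close> lifts \<open>\<gamma>\<close> through the composite, then
  \<open>poly G \<circ> h\<close> lifts it through \<open>F\<close>. This is the equivariance of
  \<open>G\<close> between the two fibres.\<close>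

lemma lift_end_pcompose:
  assumes "degree F \<ge> 1" "degree G \<ge> 1"
    and "path \<gamma>" "path_image \<gamma> \<subseteq> - critical_values (pcompose F G)"
    and "x \<in> fibre (pcompose F G) (pathstart \<gamma>)"
  shows "lift_end F \<gamma> (poly G x) = poly G (lift_end (pcompose F G) \<gamma> x)"
proof -
  have deg: "degree (pcompose F G) \<ge> 1"
    using assms by (simp add: degree_pcompose)
  obtain h where h: "is_lift (pcompose F G) \<gamma> h" "pathstart h = x"
    using is_lift_exists[OF deg assms(3,4,5)] by metis
  then have "is_lift F \<gamma> (poly G \<circ> h)"
    by (auto simp: is_lift_def poly_pcompose path_def intro!: continuous_on_compose continuous_intros)
  moreover have "path_image \<gamma> \<subseteq> - critical_values F"
    using assms critical_values_pcompose by blast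
  ultimately have "lift_end F \<gamma> (poly G x) = pathfinish (poly G \<circ> h)"
    using h assms by (intro lift_end_eqI) (auto simp: pathstart_def)
  also have "\<dots> = poly G (lift_end (pcompose F G) \<gamma> x)"
    using lift_end_eqI[OF deg assms(4) h assms(3)] by (simp add: pathfinish_def)
  finally show ?thesis .
qed

subsection \<open>Permutations that are a single cycle\<close>

text \<open>The points before the first return to \<open>x\<close> are distinct and exhaust
  \<open>S\<close>, so the return time \<open>m\<close> is \<open>card S\<close>. Exponents can thus
  be compared modulo the size of the fibre.\<close>

lemma funpow_eq_iff_single_cycle:
  assumes "finite S" "x \<in> S" "s ` S \<subseteq> S" "inj_on s S"
    and orbit: "\<And>y. y \<in> S \<Longrightarrow> \<exists>k. (s ^^ k) x = y"
  shows "(s ^^ i) x = (s ^^ j) x \<longleftrightarrow> i mod card S = j mod card S"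
proof -
  have mem: "(s ^^ k) y \<in> S" if "y \<in> S" for k y
    using assms(3) that by (induction k) auto
  have inj: "inj_on (s ^^ k) S" for k
  proof (induction k)
    case (Suc k)
    then show ?case
      using mem assms(4) by (auto simp: inj_on_def)
  qed auto
  have cancel: "(s ^^ (j - i)) x = x" if "(s ^^ i) x = (s ^^ j) x" "i \<le> j" for i j
  proof -
    have "(s ^^ i) ((s ^^ (j - i)) x) = (s ^^ i) x"
      using that by (metis comp_apply funpow_add le_add_diff_inverse)
    then show ?thesis
      using inj[of i] mem assms(2) by (auto dest!: inj_onD)
  qed
  \<comment> \<open>Pigeonhole: infinitely many exponents land in the finite set \<open>S\<close>,
    so by cancellation some positive power fixes \<open>x\<close>.\<close>
  have "\<not> inj (\<lambda>k. (s ^^ k) x)"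
    using mem assms(1,2) finite_subset finite_imageD infinite_UNIV_nat
    by (metis image_subsetI)
  then obtain i' j' where "(s ^^ i') x = (s ^^ j') x" "i' < j'"
    by (metis injI linorder_neqE_nat)
  then have ex: "\<exists>m>0. (s ^^ m) x = x"
    using cancel[of i' j'] by (intro exI[of _ "j' - i'"]) auto
  define m where "m = (LEAST m. 0 < m \<and> (s ^^ m) x = x)"
  have m: "m > 0" "(s ^^ m) x = x"
    using LeastI_ex[OF ex] by (auto simp: m_def)
  have least: "m \<le> k" if "k > 0" "(s ^^ k) x = x" for k
    using that by (auto simp: m_def intro: Least_le)
  have inj_m: "inj_on (\<lambda>k. (s ^^ k) x) {..<m}"
  proof (rule linorder_inj_onI')
    fix i j assume "i \<in> {..<m}" "j \<in> {..<m}" "i < j"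
    then show "(s ^^ i) x \<noteq> (s ^^ j) x"
      using cancel[of i j] least[of "j - i"] by fastforce
  qed
  have mod: "(s ^^ (k mod m)) x = (s ^^ k) x" for k
    using m(2) by (rule funpow_mod_eq)
  have "S = (\<lambda>k. (s ^^ k) x) ` {..<m}"
  proof
    show "S \<subseteq> (\<lambda>k. (s ^^ k) x) ` {..<m}"
    proof
      fix y assume "y \<in> S"
      then obtain k where "(s ^^ k) x = y"
        using orbit by metis
      then show "y \<in> (\<lambda>k. (s ^^ k) x) ` {..<m}"
        using mod m(1) by (intro image_eqI[of _ _ "k mod m"]) auto
    qed
  qed (use mem assms(2) in auto)
  then have card: "card S = m"
    using inj_m by (simp add: card_image)
  show ?thesis
  proof
    assume "(s ^^ i) x = (s ^^ j) x"
    then show "i mod card S = j mod card S"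
      using inj_onD[OF inj_m, of "i mod m" "j mod m"] m(1) by (simp add: mod card)
  next
    assume "i mod card S = j mod card S"
    then show "(s ^^ i) x = (s ^^ j) x"
      using mod[of i] mod[of j] by (simp add: card)
  qed
qed

subsection \<open>A loop around infinity\<close>

text \<open>In a suitable coordinate \<open>F\<close> is an exact power near infinity. Pulling a
  small circle back through that coordinate gives a curve \<open>H\<close> over the circle of radius
  \<open>\<rho>\<close> that closes up only after \<open>degree F\<close> turns.\<close>

lemma poly_near_infinity:
  fixes F :: "complex poly"
  assumes D: "degree F \<ge> 1"
  obtains H \<rho> where "\<rho> > M" "continuous_on UNIV H" "inj_on H {0..<real (degree F)}"
    "\<And>t. poly F (H t) = of_real \<rho> * exp (2 * pi * \<i> * of_real t)"
    "\<And>t. H (t + real (degree F)) = H t"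
proof -
  let ?D = "degree F" and ?P = "reflect_poly F"
  define l where "l = lead_coeff F"
  \<comment> \<open>The constant term of \<open>?P\<close> is the leading coefficient of
    \<open>F\<close>, so \<open>u 0 = 1\<close>; the constant \<open>c\<close> is a root of order
    \<open>?D\<close> of \<open>l\<close>.\<close>
  define u where "u = (\<lambda>z. poly ?P z / l)"
  define c where "c = exp (Ln l / of_nat ?D)"
  \<comment> \<open>A local coordinate at infinity: \<open>g z ^ degree F = 1 / F (1 / z)\<close> near \<open>0\<close>.\<close>
  define g where "g = (\<lambda>z. z / (c * exp (Ln (u z) / of_nat ?D)))"
  have l: "l \<noteq> 0"
    using D by (auto simp: l_def)
  have c: "c \<noteq> 0" "c ^ ?D = l"
    using D l by (auto simp: c_def simp flip: exp_of_nat_mult)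
  \<comment> \<open>On the right half plane the principal logarithm of \<open>u\<close> is
    holomorphic.\<close>
  define A where "A = {z. Re (u z) > 0}"
  have "open A"
    unfolding A_def u_def by (intro open_Collect_less continuous_intros) (use l in auto)
  have A0: "0 \<in> A"
    using l by (simp add: A_def u_def l_def)
  have hol_u: "u holomorphic_on A"
    unfolding u_def by (intro holomorphic_intros) (use l in auto)
  have hol: "g holomorphic_on A"
    unfolding g_def
    by (intro holomorphic_intros hol_u) (use c in \<open>auto simp: A_def complex_nonpos_Reals_iff\<close>)
  have pow: "g z ^ ?D * poly ?P z = z ^ ?D" if "z \<in> A" for z
  proof -
    have "u z \<noteq> 0"
      using that by (auto simp: A_def)
    then have "exp (Ln (u z) / of_nat ?D) ^ ?D = u z"
      using D by (simp flip: exp_of_nat_mult)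
    then show ?thesis
      using \<open>u z \<noteq> 0\<close> l c by (simp add: g_def power_divide power_mult_distrib u_def)
  qed
  have "(g has_field_derivative 1 / c) (at 0)"
  proof -
    let ?e = "\<lambda>z. c * exp (Ln (u z) / of_nat ?D)"
    have "?e holomorphic_on A"
      by (intro holomorphic_intros hol_u) (auto simp: A_def complex_nonpos_Reals_iff)
    then have "(?e has_field_derivative deriv ?e 0) (at 0)"
      using A0 \<open>open A\<close> holomorphic_derivI by blast
    from DERIV_divide[OF DERIV_ident this] show ?thesis
      using c l by (simp add: g_def u_def l_def)
  qed
  then have "deriv g 0 \<noteq> 0"
    using c DERIV_imp_deriv by fastforce
  then obtain r where r: "r > 0" "ball 0 r \<subseteq> A" "inj_on g (ball 0 r)"
    using has_complex_derivative_locally_injective[OF hol A0 \<open>open A\<close>] by metis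
  have hol_r: "g holomorphic_on ball 0 r"
    using hol r holomorphic_on_subset by blast
  obtain \<psi> where \<psi>: "\<psi> holomorphic_on (g ` ball 0 r)" "\<And>z. z \<in> ball 0 r \<Longrightarrow> \<psi> (g z) = z"
    using holomorphic_has_inverse[OF hol_r _ r(3)] by blast
  have "open (g ` ball 0 r)"
    using open_mapping_thm3[OF hol_r _ r(3)] by simp
  moreover have "0 \<in> g ` ball 0 r"
    using r(1) by (intro image_eqI[of _ _ 0]) (auto simp: g_def)
  ultimately obtain \<delta> where \<delta>: "\<delta> > 0" "ball 0 \<delta> \<subseteq> g ` ball 0 r"
    by (metis open_contains_ball)
  have \<psi>_r: "\<psi> s \<in> ball 0 r" "g (\<psi> s) = s" if "s \<in> ball 0 \<delta>" for s
  proof -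
    obtain z where "z \<in> ball 0 r" "s = g z"
      using \<delta>(2) \<open>s \<in> ball 0 \<delta>\<close> by blast
    then show "\<psi> s \<in> ball 0 r" "g (\<psi> s) = s"
      using \<psi>(2) by simp_all
  qed
  have \<psi>_nz: "\<psi> s \<noteq> 0" if "s \<in> ball 0 \<delta>" "s \<noteq> 0" for s
    using \<psi>_r(2)[OF that(1)] that(2) by (auto simp: g_def)
  have F\<psi>: "poly F (inverse (\<psi> s)) = inverse s ^ ?D" if "s \<in> ball 0 \<delta>" "s \<noteq> 0" for s
  proof -
    have "\<psi> s \<in> A"
      using \<psi>_r(1)[OF that(1)] r(2) by blast
    then have "s ^ ?D * (\<psi> s ^ ?D * poly F (inverse (\<psi> s))) = \<psi> s ^ ?D"
      using pow[of "\<psi> s"] \<psi>_r(2)[OF that(1)] poly_reflect_poly_nz[OF \<psi>_nz[OF that], of F] by simp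
    then show ?thesis
      using that(2) \<psi>_nz[OF that] by (simp add: field_simps)
  qed
  \<comment> \<open>The first bound keeps the circle inside the domain of \<open>\<psi>\<close>; the
    second makes \<open>inverse s\<close> exceed \<open>M\<close> and 1, so its power
    \<open>\<rho>\<close> exceeds \<open>M\<close>.\<close>
  define s where "s = min (\<delta> / 2) (inverse (\<bar>M\<bar> + 2))"
  have s: "0 < s" "s < \<delta>" "s \<le> inverse (\<bar>M\<bar> + 2)"
    using \<delta> by (auto simp: s_def)
  \<comment> \<open>By \<open>F\<psi>\<close> the value of \<open>F\<close> is the inverse of the
    power of order \<open>?D\<close>; the sign and the division by \<open>?D\<close> make
    \<open>F (H t)\<close> turn once, counterclockwise, per unit of \<open>t\<close>.\<close>
  define a where "a = (\<lambda>t::real. of_real s * exp (- (2 * pi * \<i> * of_real t / of_nat ?D)))"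
  have norm_a: "norm (a t) = s" for t
    using s by (simp add: a_def norm_mult)
  have a: "a t \<in> ball 0 \<delta>" "a t \<noteq> 0" for t
    using s norm_a[of t] by auto
  define H where "H = (\<lambda>t. inverse (\<psi> (a t)))"
  show ?thesis
  proof
    have "M < inverse s"
      using s(1,3) le_imp_inverse_le[OF s(3,1)] by simp
    moreover have "inverse s \<ge> 1"
      using le_imp_inverse_le[OF s(3,1)] by simp
    then have "inverse s ^ 1 \<le> inverse s ^ ?D"
      using D by (intro power_increasing) auto
    ultimately show "inverse s ^ ?D > M"
      by simp
    have "continuous_on (ball 0 \<delta>) \<psi>"
      using \<psi>(1) \<delta>(2) continuous_on_subset holomorphic_on_imp_continuous_on by blast
    then have "continuous_on UNIV (\<lambda>t. \<psi> (a t))"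
      by (rule continuous_on_compose2) (use D a in \<open>auto simp: a_def intro!: continuous_intros\<close>)
    then show "continuous_on UNIV H"
      unfolding H_def using \<psi>_nz a by (intro continuous_intros) auto
    show "poly F (H t) = of_real (inverse s ^ ?D) * exp (2 * pi * \<i> * of_real t)" for t
    proof -
      have "poly F (H t) = inverse (a t ^ ?D)"
        using F\<psi>[OF a] by (simp add: H_def power_inverse)
      also have "a t ^ ?D = of_real s ^ ?D * exp (- (2 * pi * \<i> * of_real t))"
        using D by (simp add: a_def power_mult_distrib flip: exp_of_nat_mult)
      finally show ?thesis
        by (simp add: exp_minus power_inverse)
    qed
    show "H (t + real ?D) = H t" for t
    proof -
      have "exp (- (2 * pi * \<i> * of_real (t + real ?D) / of_nat ?D)) =
          exp (- (2 * pi * \<i> * of_real t / of_nat ?D) - 2 * pi * \<i>)"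
        using D by (intro arg_cong[of _ _ exp]) (simp add: field_simps)
      also have "\<dots> = exp (- (2 * pi * \<i> * of_real t / of_nat ?D))"
        by (simp add: exp_diff)
      finally show ?thesis
        by (simp add: H_def a_def)
    qed
    show "inj_on H {0..<real ?D}"
    proof (rule inj_onI)
      fix t t' assume tt: "t \<in> {0..<real ?D}" "t' \<in> {0..<real ?D}" and "H t = H t'"
      then have "a t = a t'"
        using \<psi>_r(2)[OF a(1)] unfolding H_def by (metis inverse_inverse_eq)
      then have "exp (- (2 * pi * \<i> * of_real t / of_nat ?D)) = exp (- (2 * pi * \<i> * of_real t' / of_nat ?D))"
        using s by (simp add: a_def)
      then obtain n :: int where
        "- (2 * pi * \<i> * of_real t / of_nat ?D) = - (2 * pi * \<i> * of_real t' / of_nat ?D) + of_int (2 * n) * pi * \<i>"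
        unfolding exp_eq by blast
      from arg_cong[OF this, of Im] have "2 * pi * (t' - t) = 2 * pi * (n * real ?D)"
        using D by (simp add: field_simps)
      then have n: "t' - t = n * real ?D"
        by simp
      then have "\<bar>of_int n * real ?D\<bar> < 1 * real ?D"
        using tt unfolding atLeastLessThan_iff by linarith
      then have "\<bar>of_int n :: real\<bar> < 1"
        using mult_right_less_imp_less[of "\<bar>of_int n\<bar>" "real ?D" 1] by (simp add: abs_mult)
      then have "n = 0"
        by linarith
      then show "t = t'"
        using n by simp
    qed
  qed
qed

text \<open>Over a circle enclosing all critical values, one turn moves \<open>H k\<close> to
  \<open>H (k + 1)\<close>, a single cycle. Transport along a path from \<open>p\<close> to the
  circle carries this cycle to the fibre over \<open>p\<close>.\<close>

lemma lift_end_cyclic_loop: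
  assumes D: "degree F \<ge> 1" and p: "p \<notin> critical_values F"
  obtains \<gamma> where "\<gamma> \<in> monodromy_loops F p"
    "\<And>x y. \<lbrakk>x \<in> fibre F p; y \<in> fibre F p\<rbrakk> \<Longrightarrow> \<exists>k. (lift_end F \<gamma> ^^ k) x = y"
proof -
  let ?D = "degree F" and ?V = "critical_values F"
  have "bounded ?V"
    by (intro finite_imp_bounded finite_critical_values D)
  then obtain M where M: "\<And>v. v \<in> ?V \<Longrightarrow> norm v \<le> M"
    by (auto simp: bounded_iff)
  obtain H \<rho> where H: "\<rho> > max M 0" "continuous_on UNIV H" "inj_on H {0..<real ?D}"
    "\<And>t. poly F (H t) = of_real \<rho> * exp (2 * pi * \<i> * of_real t)"
    "\<And>t. H (t + real ?D) = H t"
    using poly_near_infinity[OF D, of "max M 0"] by metis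
  define c where "c = (\<lambda>t::real. of_real \<rho> * exp (2 * pi * \<i> * of_real t))"
  have "norm (c t) = \<rho>" for t
    using H(1) by (simp add: c_def norm_mult)
  then have c: "path c" "path_image c \<subseteq> - ?V" "pathstart c = of_real \<rho>" "pathfinish c = of_real \<rho>"
    using H(1) M by (fastforce simp: path_def c_def path_image_def pathstart_def pathfinish_def
          intro!: continuous_intros)+
  have H_fibre: "H (real k) \<in> fibre F (of_real \<rho>)" for k
    using H(4) exp_integer_2pi[of "of_nat k"] by (simp add: fibre_def mult_ac)
  have lift_c: "lift_end F c (H (real k)) = H (real (Suc k))" for k
  proof -
    \<comment> \<open>The circle has period 1, so every integer shift of \<open>H\<close> is again a
      lift of \<open>c\<close>.\<close>
    have "exp (2 * pi * \<i> * of_real (real k + t)) = exp (2 * pi * \<i> * of_real t)" for t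
      using exp_integer_2pi[of "of_nat k"] by (simp add: ring_distribs exp_add mult_ac)
    then have "is_lift F c (\<lambda>t. H (real k + t))"
      using H(4) by (auto simp: is_lift_def path_def c_def
          intro!: continuous_on_compose2[OF H(2)] continuous_intros)
    from lift_end_eqI[OF D c(2) this _ c(1)] show ?thesis
      by (simp add: pathstart_def pathfinish_def add.commute)
  qed
  have "path_connected (- ?V)"
    by (intro path_connected_complement_countable)
       (auto intro: countable_finite finite_critical_values D)
  moreover have "of_real \<rho> \<in> - ?V"
    using c pathstart_in_path_image by fastforce
  ultimately obtain \<delta> where \<delta>: "path \<delta>" "path_image \<delta> \<subseteq> - ?V" "pathstart \<delta> = p"
      "pathfinish \<delta> = of_real \<rho>"
    using p unfolding path_connected_def by blast
  define x where "x = (\<lambda>k. lift_end F (reversepath \<delta>) (H (real k)))"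
  define \<gamma> where "\<gamma> = \<delta> +++ (c +++ reversepath \<delta>)"
  have x_fibre: "x k \<in> fibre F p" for k
    using lift_end_fibre[OF D, of "reversepath \<delta>" "H (real k)"] \<delta> H_fibre by (simp add: x_def)
  have lift_\<delta>: "lift_end F \<delta> (x k) = H (real k)" for k
    using lift_end_reversepath[OF D, of "reversepath \<delta>" "H (real k)"] \<delta> H_fibre by (simp add: x_def)
  have step: "lift_end F \<gamma> (x k) = x (Suc k)" for k
  proof -
    have "lift_end F \<gamma> (x k) = lift_end F (c +++ reversepath \<delta>) (lift_end F \<delta> (x k))"
      unfolding \<gamma>_def by (intro lift_end_joinpaths D) (use \<delta> c x_fibre in \<open>auto simp: path_image_join\<close>)
    also have "\<dots> = lift_end F (reversepath \<delta>) (lift_end F c (H (real k)))"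
      unfolding lift_\<delta> by (intro lift_end_joinpaths D) (use \<delta> c H_fibre in auto)
    finally show ?thesis
      by (simp add: lift_c x_def del: of_nat_Suc)
  qed
  have steps: "(lift_end F \<gamma> ^^ k) (x i) = x (i + k)" for i k
    by (induction k) (simp_all add: step)
  have "inj_on x {..<?D}"
  proof (rule inj_onI)
    fix i j assume "i \<in> {..<?D}" "j \<in> {..<?D}" "x i = x j"
    then show "i = j"
      using lift_\<delta>[of i] lift_\<delta>[of j] inj_onD[OF H(3), of "real i" "real j"] by simp
  qed
  then have "x ` {..<?D} = fibre F p"
    using x_fibre card_fibre[OF D p] finite_fibre[OF D] by (intro card_subset_eq) (auto simp: card_image)
  have period: "x (k + ?D) = x k" for k
    by (simp add: x_def H(5))
  show thesis
  proof
    show "\<gamma> \<in> monodromy_loops F p"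
      using \<delta> c by (auto simp: \<gamma>_def monodromy_loops_def path_image_join)
    fix y z assume "y \<in> fibre F p" "z \<in> fibre F p"
    then obtain i j where "i < ?D" "y = x i" "z = x j"
      using \<open>x ` {..<?D} = fibre F p\<close> by (metis imageE lessThan_iff)
    \<comment> \<open>Adding \<open>?D\<close> prevents truncated subtraction when
      \<open>j < i\<close>; the period removes it again.\<close>
    then show "\<exists>k. (lift_end F \<gamma> ^^ k) y = z"
      using steps[of "j + ?D - i" i] period[of j] by auto
  qed
qed

subsection \<open>Moving paths off a finite set\<close>

text \<open>A path close to \<open>\<gamma>\<close> with the same ends is homotopic to it in
  \<open>U\<close>. A polynomial approximation, bent by a small generic multiple of
  \<open>t * (1 - t)\<close>, stays close, keeps the ends and misses \<open>S\<close>.\<close>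

lemma homotopic_path_avoiding_finite:
  fixes \<gamma> :: "real \<Rightarrow> complex"
  assumes \<gamma>: "path \<gamma>" "path_image \<gamma> \<subseteq> U" and "open U" "finite S"
    and ends: "pathstart \<gamma> \<notin> S" "pathfinish \<gamma> \<notin> S"
  obtains \<gamma>' where "homotopic_paths U \<gamma> \<gamma>'" "path_image \<gamma>' \<subseteq> - S"
proof -
  obtain e where e: "e > 0" "(\<Union>x\<in>path_image \<gamma>. ball x e) \<subseteq> U"
    using compact_subset_open_imp_ball_epsilon_subset[OF compact_path_image[OF \<gamma>(1)] \<open>open U\<close> \<gamma>(2)] .
  \<comment> \<open>Half of the margin \<open>e\<close> is spent on the approximation, half on the
    later perturbation.\<close>
  obtain g where g: "polynomial_function g" "pathstart g = pathstart \<gamma>" "pathfinish g = pathfinish \<gamma>"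
    and near: "\<And>t. t \<in> {0..1} \<Longrightarrow> norm (g t - \<gamma> t) < e / 2"
    using path_approx_polynomial_function[OF \<gamma>(1), of "e / 2"] e by auto
  \<comment> \<open>The \<open>c\<close> for which the path \<open>g t + t (1 - t) c\<close> meets \<open>S\<close> form a null set.\<close>
  define bad where "bad = (\<Union>s\<in>S. (\<lambda>t. inverse (t * (1 - t)) *\<^sub>R (s - g t)) ` {0<..<1})"
  \<comment> \<open>A differentiable image of a real interval in the plane, of real dimension 2, has
    measure zero.\<close>
  have "negligible ((\<lambda>t. inverse (t * (1 - t)) *\<^sub>R (s - g t)) ` {0<..<1})" for s
  proof (rule negligible_differentiable_image_lowdim)
    show "(\<lambda>t. inverse (t * (1 - t)) *\<^sub>R (s - g t)) differentiable_on {0<..<1}"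
      using g(1) unfolding differentiable_on_def
      by (intro ballI derivative_intros differentiable_at_polynomial_function) auto
  qed auto
  then have "negligible bad"
    unfolding bad_def using \<open>finite S\<close> by (intro negligible_Union) auto
  then have "\<not> ball 0 (e / 2) \<subseteq> bad"
    using negligible_subset open_not_negligible[of "ball (0::complex) (e / 2)"] e(1) by auto
  then obtain c where "c \<in> ball 0 (e / 2)" and c_bad: "c \<notin> bad"
    by blast
  then have norm_c: "norm c < e / 2"
    by simp
  define h where "h = (\<lambda>t. g t + (t * (1 - t)) *\<^sub>R c)"
  have h_ends: "pathstart h = pathstart \<gamma>" "pathfinish h = pathfinish \<gamma>"
    using g by (simp_all add: h_def pathstart_def pathfinish_def)
  show ?thesis
  proof
    show "homotopic_paths U \<gamma> h"
    proof (rule homotopic_paths_nearby_explicit[OF \<gamma>(1) _ h_ends])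
      show "path h"
        unfolding path_def h_def
        by (intro continuous_intros continuous_on_polymonial_function g)
      fix t x assume t: "t \<in> {0..1::real}" and x: "x \<notin> U"
      have "norm (h t - \<gamma> t) \<le> norm (g t - \<gamma> t) + norm ((t * (1 - t)) *\<^sub>R c)"
        using norm_triangle_ineq[of "g t - \<gamma> t" "(t * (1 - t)) *\<^sub>R c"] by (simp add: h_def algebra_simps)
      also have "norm ((t * (1 - t)) *\<^sub>R c) \<le> 1 * norm c"
        using t unfolding norm_scaleR
        by (intro mult_right_mono) (auto simp: abs_mult intro!: mult_le_one)
      finally have "norm (h t - \<gamma> t) < e"
        using near[OF t] norm_c by simp
      also have "e \<le> norm (\<gamma> t - x)"
      proof (rule ccontr)
        assume "\<not> e \<le> norm (\<gamma> t - x)"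
        then have "x \<in> ball (\<gamma> t) e"
          by (simp add: dist_norm)
        then show False
          using e(2) x t unfolding path_image_def by blast
      qed
      finally show "norm (h t - \<gamma> t) < norm (\<gamma> t - x)" .
    qed
    show "path_image h \<subseteq> - S"
    proof
      fix z assume "z \<in> path_image h"
      then obtain t where t: "t \<in> {0..1}" "z = h t"
        by (auto simp: path_image_def)
      consider "t = 0" | "t = 1" | "0 < t" "t < 1"
        using t by fastforce
      then show "z \<in> - S"
      proof cases
        case 3
        have "z \<notin> S"
        proof
          assume "z \<in> S"
          moreover have "c = inverse (t * (1 - t)) *\<^sub>R (z - g t)"
          proof -
            have "t * (1 - t) \<noteq> 0"
              using 3 by simp
            moreover have "inverse u *\<^sub>R (u *\<^sub>R c) = c" if "u \<noteq> 0" for u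
              using that by simp
            moreover have "z - g t = (t * (1 - t)) *\<^sub>R c"
              using t(2) by (simp add: h_def)
            ultimately show ?thesis
              by metis
          qed
          ultimately show False
            using c_bad 3 by (auto simp: bad_def)
        qed
        then show ?thesis by simp
      qed (use t h_ends ends in \<open>auto simp: pathstart_def pathfinish_def\<close>)
    qed
  qed
qed

subsection \<open>Monodromy and blocks\<close>

text \<open>Concatenating a loop with itself iterates its action, starting from the constant loop.
  The block condition thus applies to every power of the cycle.\<close>

lemma lift_end_funpow_loop:
  assumes D: "degree F \<ge> 1" and \<gamma>: "\<gamma> \<in> monodromy_loops F p"
  shows "\<exists>\<delta>\<in>monodromy_loops F p. \<forall>x\<in>fibre F p. lift_end F \<delta> x = (lift_end F \<gamma> ^^ k) x"
proof (induction k)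
  case 0
  have "p \<notin> critical_values F"
    using \<gamma> pathstart_in_path_image by (fastforce simp: monodromy_loops_def)
  then have c: "path (linepath p p)" "path_image (linepath p p) \<subseteq> - critical_values F"
    by auto
  have "lift_end F (linepath p p) x = (lift_end F \<gamma> ^^ 0) x" if "x \<in> fibre F p" for x
  proof -
    have "is_lift F (linepath p p) (linepath x x)"
      using that by (simp add: is_lift_def) (simp add: fibre_def linepath_refl)
    then show ?thesis
      using lift_end_eqI[OF D c(2) _ _ c(1)] by force
  qed
  moreover have "linepath p p \<in> monodromy_loops F p"
    using c by (simp add: monodromy_loops_def)
  ultimately show ?case
    by blast
next
  case (Suc k)
  then obtain \<delta> where \<delta>: "\<delta> \<in> monodromy_loops F p"
    "\<And>x. x \<in> fibre F p \<Longrightarrow> lift_end F \<delta> x = (lift_end F \<gamma> ^^ k) x"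
    by blast
  show ?case
  proof (intro bexI ballI)
    show "\<delta> +++ \<gamma> \<in> monodromy_loops F p"
      using \<delta> \<gamma> by (auto simp: monodromy_loops_def path_image_join)
    show "lift_end F (\<delta> +++ \<gamma>) x = (lift_end F \<gamma> ^^ Suc k) x" if "x \<in> fibre F p" for x
      using \<delta> \<gamma> that lift_end_joinpaths[OF D, of \<delta> \<gamma> x] by (simp add: monodromy_loops_def)
  qed
qed

lemma lift_end_loop_image:
  assumes "degree F \<ge> 1" "\<gamma> \<in> monodromy_loops F p"
  shows "lift_end F \<gamma> ` fibre F p \<subseteq> fibre F p" "inj_on (lift_end F \<gamma>) (fibre F p)"
  using lift_end_fibre[OF assms(1), of \<gamma>] inj_on_lift_end[OF assms(1), of \<gamma>] assms(2)
  by (auto simp: monodromy_loops_def)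

text \<open>The maps are injective and \<open>B\<close> is finite, so mapping \<open>B\<close> into
  itself is the same as mapping it onto itself. Blocks can then be handled through endpoints of
  lifts alone.\<close>

lemma is_block_monodromy_group_iff:
  assumes D: "degree F \<ge> 1" and "B \<subseteq> fibre F p"
  shows "is_block (monodromy_group F p) (fibre F p) (\<lambda>\<sigma>. \<sigma>) B \<longleftrightarrow>
    (\<forall>\<gamma>\<in>monodromy_loops F p. \<forall>x\<in>B. lift_end F \<gamma> x \<in> B \<longrightarrow> lift_end F \<gamma> ` B \<subseteq> B)"
proof -
  have "monodromy_perm F p \<gamma> ` B = lift_end F \<gamma> ` B" for \<gamma>
    using assms(2) by (force simp: monodromy_perm_def)
  moreover have "lift_end F \<gamma> ` B \<inter> B = B \<longleftrightarrow> lift_end F \<gamma> ` B \<subseteq> B" if "\<gamma> \<in> monodromy_loops F p" for \<gamma>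
  proof -
    have "finite B" "inj_on (lift_end F \<gamma>) B"
      using finite_fibre[OF D] lift_end_loop_image[OF D that] assms(2)
      by (auto intro: finite_subset inj_on_subset)
    then have card: "finite (lift_end F \<gamma> ` B)" "card (lift_end F \<gamma> ` B) = card B"
      by (auto simp: card_image)
    show ?thesis
      using card_subset_eq[OF \<open>finite B\<close> _ card(2)] card_subset_eq[OF card(1) _ card(2)[symmetric]]
      by blast
  qed
  ultimately show ?thesis
    using assms(2) unfolding is_block_def monodromy_group_def by simp blast
qed

lemma is_block_fibre:
  assumes "degree F \<ge> 1"
  shows "is_block (monodromy_group F p) (fibre F p) (\<lambda>\<sigma>. \<sigma>) (fibre F p)"
  using lift_end_loop_image(1)[OF assms] by (simp add: is_block_monodromy_group_iff[OF assms])

text \<open>All \<open>s ^^ (k * j)\<close> keep \<open>a\<close> in \<open>B\<close>, and since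
  \<open>k\<close> is invertible modulo the cycle length \<open>d ^ n\<close>, these exponents reach
  every residue.\<close>

lemma single_cycle_block_full:
  assumes S: "finite S" "s ` S \<subseteq> S" "inj_on s S" "card S = d ^ n"
    and orbit: "\<And>y. y \<in> S \<Longrightarrow> \<exists>k. (s ^^ k) a = y"
    and B: "B \<subseteq> S" "a \<in> B" "(s ^^ k) a \<in> B" "(s ^^ k) ` B \<subseteq> B"
    and "coprime k d"
  shows "B = S"
proof
  show "S \<subseteq> B"
  proof
    fix y assume "y \<in> S"
    then obtain i where i: "(s ^^ i) a = y"
      using orbit by metis
    have mult: "(s ^^ (k * j)) a \<in> B" for j
    proof (induction j)
      case (Suc j)
      then show ?case
        using B(4) by (auto simp: funpow_add)
    qed (use B in auto)
    have "coprime k (d ^ n)"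
      using assms(10) by simp
    then obtain j where "[k * j = 1] (mod d ^ n)"
      using cong_solve_coprime_nat[of k "d ^ n"] by (metis One_nat_def)
    then have "[k * j * i = 1 * i] (mod d ^ n)"
      by (rule cong_scalar_right)
    then have "(s ^^ (k * (j * i))) a = (s ^^ i) a"
      using funpow_eq_iff_single_cycle[OF S(1) _ S(2,3) orbit] B
      by (auto simp: S(4) cong_def mult.assoc)
    then show "y \<in> B"
      using mult[of "j * i"] i by simp
  qed
qed fact

text \<open>A loop for \<open>F\<close> may meet critical values that only the composite has. A
  homotopy avoiding the critical values of \<open>F\<close> moves it off them and leaves its action
  on the fibre of \<open>F\<close> unchanged.\<close>

lemma monodromy_loop_lift:
  assumes D: "degree F \<ge> 1" "degree G \<ge> 1" and p: "p \<notin> critical_values (pcompose F G)"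
    and \<gamma>: "\<gamma> \<in> monodromy_loops F p"
  obtains \<gamma>' where "\<gamma>' \<in> monodromy_loops (pcompose F G) p"
    "\<And>x. x \<in> fibre (pcompose F G) p \<Longrightarrow> poly G (lift_end (pcompose F G) \<gamma>' x) = lift_end F \<gamma> (poly G x)"
proof -
  let ?V = "critical_values (pcompose F G)"
  have deg: "degree (pcompose F G) \<ge> 1"
    using D by (simp add: degree_pcompose)
  have "open (- critical_values F)"
    using finite_critical_values[OF D(1)] by (simp add: finite_imp_closed open_Compl)
  then obtain \<gamma>' where hom: "homotopic_paths (- critical_values F) \<gamma> \<gamma>'" and V: "path_image \<gamma>' \<subseteq> - ?V"
    using homotopic_path_avoiding_finite[of \<gamma> "- critical_values F" ?V] finite_critical_values[OF deg] p \<gamma>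
    by (auto simp: monodromy_loops_def)
  have \<gamma>': "\<gamma>' \<in> monodromy_loops (pcompose F G) p"
    using V \<gamma> homotopic_paths_imp_path[OF hom] homotopic_paths_imp_pathstart[OF hom]
      homotopic_paths_imp_pathfinish[OF hom] by (simp add: monodromy_loops_def)
  show thesis
  proof
    fix x assume x: "x \<in> fibre (pcompose F G) p"
    then have "lift_end F \<gamma>' (poly G x) = lift_end F \<gamma> (poly G x)"
      using lift_end_homotopic[OF D(1) hom, of "poly G x"] \<gamma>
      by (simp add: fibre_def poly_pcompose monodromy_loops_def)
    then show "poly G (lift_end (pcompose F G) \<gamma>' x) = lift_end F \<gamma> (poly G x)"
      using lift_end_pcompose[OF D, of \<gamma>' x] \<gamma>' x by (simp add: monodromy_loops_def)
  qed fact
qed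

text \<open>The iterate is replaced by any \<open>G\<close> whose degree is a power of
  \<open>degree f\<close>: then the cycle length upstairs is such a power too, and an exponent
  coprime to \<open>degree f\<close> suffices.\<close>

lemma block_pcompose_eq_fibre:
  fixes f G :: "complex poly"
  defines "F \<equiv> pcompose f G"
  assumes d: "degree f \<ge> 2" and degG: "degree G = degree f ^ m" and p: "p \<notin> critical_values F"
    and prim: "prime (degree f) \<or>
      primitive_action (monodromy_group f p) (fibre f p) (\<lambda>\<sigma>. \<sigma>)"
    and block: "is_block (monodromy_group F p) (fibre F p) (\<lambda>\<sigma>. \<sigma>) B"
    and ab: "a \<in> B" "b \<in> B" "poly G a \<noteq> poly G b"
  shows "B = fibre F p"
proof -
  let ?S = "fibre F p" and ?R = "fibre f p" and ?g = "poly G"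
  have D: "degree f \<ge> 1" "degree G \<ge> 1" "degree F \<ge> 1" and degF: "degree F = degree f ^ Suc m"
    using d by (auto simp: F_def degG degree_pcompose)
  have p_f: "p \<notin> critical_values f"
    using p critical_values_pcompose[OF D(2)] by (auto simp: F_def)
  have BS: "B \<subseteq> ?S"
    using block by (simp add: is_block_def)
  have stab: "lift_end F \<gamma> ` B \<subseteq> B" if "\<gamma> \<in> monodromy_loops F p" "x \<in> B" "lift_end F \<gamma> x \<in> B" for \<gamma> x
    using block that is_block_monodromy_group_iff[OF D(3) BS] by blast
  have g_mem: "?g x \<in> ?R" if "x \<in> ?S" for x
    using that by (simp add: F_def fibre_def poly_pcompose)
  have g_onto: "\<exists>x\<in>?S. ?g x = y" if "y \<in> ?R" for y
    using that poly_surj_complex[OF D(2), of y] by (auto simp: F_def fibre_def poly_pcompose)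
  obtain \<gamma> where \<gamma>: "\<gamma> \<in> monodromy_loops F p"
    and orbit: "\<And>x y. x \<in> ?S \<Longrightarrow> y \<in> ?S \<Longrightarrow> \<exists>k. (lift_end F \<gamma> ^^ k) x = y"
    using lift_end_cyclic_loop[OF D(3) p] by metis
  define s where "s = lift_end F \<gamma>"
  define t where "t = lift_end f \<gamma>"
  have \<gamma>_f: "\<gamma> \<in> monodromy_loops f p"
    using \<gamma> critical_values_pcompose[OF D(2), of f] by (auto simp: monodromy_loops_def F_def)
  have s: "s ` ?S \<subseteq> ?S" "inj_on s ?S" and t: "t ` ?R \<subseteq> ?R" "inj_on t ?R"
    using lift_end_loop_image D \<gamma> \<gamma>_f by (auto simp: s_def t_def)
  have s_mem: "(s ^^ k) x \<in> ?S" if "x \<in> ?S" for k x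
    using that s(1) by (induction k) auto
  have equiv: "?g ((s ^^ k) x) = (t ^^ k) (?g x)" if "x \<in> ?S" for k x
  proof (induction k)
    case (Suc k)
    then show ?case
      using lift_end_pcompose[OF D(1,2), of \<gamma> "(s ^^ k) x"] \<gamma> s_mem[OF that, of k]
      by (simp add: s_def t_def F_def monodromy_loops_def)
  qed simp
  \<comment> \<open>Lifting both points to \<open>?S\<close> shows that \<open>t\<close> is a single
    cycle as well, of length \<open>degree f\<close>.\<close>
  have orbit_R: "\<exists>k. (t ^^ k) y = z" if "y \<in> ?R" "z \<in> ?R" for y z
    using that g_onto orbit equiv unfolding s_def by metis
  have t_eq: "(t ^^ i) y = (t ^^ j) y \<longleftrightarrow> i mod degree f = j mod degree f" if "y \<in> ?R" for i j y
    using funpow_eq_iff_single_cycle[OF finite_fibre[OF D(1)] that t orbit_R[OF that]]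
    by (simp add: card_fibre[OF D(1) p_f])
  have "\<exists>k. (s ^^ k) a \<in> B \<and> coprime k (degree f)"
    using prim
  proof
    assume prime: "prime (degree f)"
    obtain k where k: "(s ^^ k) a = b"
      using orbit ab BS unfolding s_def by blast
    then have "(t ^^ k) (?g a) \<noteq> (t ^^ 0) (?g a)"
      using equiv[of a k] ab BS by auto
    then have "\<not> degree f dvd k"
      using t_eq[of "?g a" k 0] g_mem[of a] ab BS by auto
    then show ?thesis
      using k ab prime_imp_coprime[OF prime] coprime_commute by blast
  next
    assume prim: "primitive_action (monodromy_group f p) (fibre f p) (\<lambda>\<sigma>. \<sigma>)"
    have gB: "?g ` B \<subseteq> ?R"
      using g_mem BS by auto
    have "is_block (monodromy_group f p) (fibre f p) (\<lambda>\<sigma>. \<sigma>) (?g ` B)"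
      unfolding is_block_monodromy_group_iff[OF D(1) gB]
    proof clarify
      fix \<delta> x y z assume \<delta>: "\<delta> \<in> monodromy_loops f p"
        and x: "x \<in> B" and y: "y \<in> B" "lift_end f \<delta> (?g x) = ?g y" and z: "z \<in> B"
      obtain \<delta>' where \<delta>': "\<delta>' \<in> monodromy_loops F p"
        and equiv': "\<And>x. x \<in> ?S \<Longrightarrow> ?g (lift_end F \<delta>' x) = lift_end f \<delta> (?g x)"
        using monodromy_loop_lift[OF D(1,2) _ \<delta>] p unfolding F_def by metis
      have mem': "lift_end F \<delta>' x \<in> ?S" if "x \<in> ?S" for x
        using lift_end_loop_image(1)[OF D(3) \<delta>'] that by blast
      \<comment> \<open>The lifted loop ends over \<open>?g y\<close> but perhaps not at
        \<open>y\<close>; a power of the cycle corrects this.\<close>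
      obtain k where k: "(s ^^ k) (lift_end F \<delta>' x) = y"
        using orbit mem' x y BS unfolding s_def by blast
      then have "(t ^^ k) (?g y) = (t ^^ 0) (?g y)"
        using equiv[OF mem', of x k] equiv' x y BS by auto
      then have "k mod degree f = 0 mod degree f"
        using t_eq[of "?g y" k 0] g_mem[of y] y BS by blast
      \<comment> \<open>So the power of the cycle carrying the lifted image of \<open>x\<close> back to \<open>y\<close> is trivial on
        \<open>fibre f p\<close>, and composing with it does not change the action downstairs.\<close>
      then have fix_R: "(t ^^ k) w = w" if "w \<in> ?R" for w
        using t_eq[OF that, of k 0] by simp
      obtain \<epsilon> where \<epsilon>: "\<epsilon> \<in> monodromy_loops F p" "\<And>x. x \<in> ?S \<Longrightarrow> lift_end F \<epsilon> x = (s ^^ k) x"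
        using lift_end_funpow_loop[OF D(3) \<gamma>, of k] unfolding s_def by metis
      have \<eta>: "\<delta>' +++ \<epsilon> \<in> monodromy_loops F p"
        using \<delta>' \<epsilon> by (auto simp: monodromy_loops_def path_image_join)
      have lift_\<eta>: "lift_end F (\<delta>' +++ \<epsilon>) w = (s ^^ k) (lift_end F \<delta>' w)" if "w \<in> ?S" for w
        using \<delta>' \<epsilon> that lift_end_joinpaths[OF D(3), of \<delta>' \<epsilon> w] mem'[OF that]
        by (simp add: monodromy_loops_def)
      \<comment> \<open>The corrected loop takes \<open>x\<close> to \<open>y\<close>, both in
        \<open>B\<close>, so it preserves \<open>B\<close>.\<close>
      have "(s ^^ k) (lift_end F \<delta>' z) \<in> B"
        using stab[OF \<eta> x] lift_\<eta> k x y z BS by (metis image_subset_iff subsetD)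
      moreover have "?g ((s ^^ k) (lift_end F \<delta>' z)) = lift_end f \<delta> (?g z)"
        using equiv[OF mem', of z k] equiv'[of z] fix_R g_mem[OF mem', of z] z BS by auto
      ultimately show "lift_end f \<delta> (?g z) \<in> ?g ` B"
        by (metis imageI)
    qed
    \<comment> \<open>The images of \<open>a\<close> and \<open>b\<close> differ, which excludes a
      singleton.\<close>
    then have "?g ` B = ?R"
      using prim ab unfolding primitive_action_def by (metis empty_iff image_eqI singletonD)
    moreover have "t (?g a) \<in> ?R"
      using t(1) g_mem ab BS by blast
    ultimately obtain c where c: "c \<in> B" "?g c = t (?g a)"
      by (metis imageE)
    then obtain k where k: "(s ^^ k) a = c"
      using orbit ab BS unfolding s_def by blast
    then have "(t ^^ k) (?g a) = (t ^^ 1) (?g a)"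
      using equiv[of a k] c ab BS by auto
    \<comment> \<open>Here \<open>degree f \<ge> 2\<close> makes 1 its own residue.\<close>
    then have "k mod degree f = 1"
      using t_eq[of "?g a" k 1] g_mem[of a] ab BS d by auto
    then have "coprime k (degree f)"
      by (metis coprime_1_left coprime_mod_left_iff d not_numeral_le_zero)
    then show ?thesis
      using k c by blast
  qed
  then obtain k where k: "(s ^^ k) a \<in> B" "coprime k (degree f)"
    by blast
  \<comment> \<open>The power \<open>s ^^ k\<close> is induced by a loop and keeps \<open>a\<close>
    in \<open>B\<close>, hence it preserves \<open>B\<close>.\<close>
  obtain \<epsilon> where \<epsilon>: "\<epsilon> \<in> monodromy_loops F p" "\<And>x. x \<in> ?S \<Longrightarrow> lift_end F \<epsilon> x = (s ^^ k) x"
    using lift_end_funpow_loop[OF D(3) \<gamma>, of k] unfolding s_def by metis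
  then have "(s ^^ k) ` B \<subseteq> B"
    using stab[OF \<epsilon>(1) ab(1)] k(1) ab(1) BS by (metis image_cong subsetD)
  moreover have "card ?S = degree f ^ Suc m"
    using card_fibre[OF D(3) p] degF by simp
  moreover have "\<And>y. y \<in> ?S \<Longrightarrow> \<exists>k. (s ^^ k) a = y"
    using orbit ab(1) BS unfolding s_def by blast
  ultimately show ?thesis
    using single_cycle_block_full[OF finite_fibre[OF D(3)] s _ _ BS ab(1) k(1) _ k(2)] by blast
qed

theorem theorem1p1:
  fixes f :: "complex poly" and n :: nat and p a b :: complex and E :: "complex set"
  assumes "degree f \<ge> 2"
    and "n \<ge> 1"
    and "p \<notin> critical_values (poly_iter n f)"
    and "prime (degree f) \<or> primitive_action (monodromy_group f p) (fibre f p) (\<lambda>\<sigma>. \<sigma>)"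
    and "E \<subseteq> fibre (poly_iter n f) p"
    and "a \<in> E" and "b \<in> E"
    and "poly (poly_iter (n - 1) f) a \<noteq> poly (poly_iter (n - 1) f) b"
  shows "is_smallest_block (monodromy_group (poly_iter n f) p) (fibre (poly_iter n f) p) (\<lambda>\<sigma>. \<sigma>)
           E (fibre (poly_iter n f) p)"
proof -
  have n: "poly_iter n f = pcompose f (poly_iter (n - 1) f)"
    using assms(2) poly_iter_Suc[of "n - 1" f] by simp
  have "degree (poly_iter n f) \<ge> 1"
    using assms(1) by (simp add: degree_poly_iter)
  then have "is_block (monodromy_group (poly_iter n f) p) (fibre (poly_iter n f) p) (\<lambda>\<sigma>. \<sigma>)
      (fibre (poly_iter n f) p)"
    by (rule is_block_fibre)
  moreover have "fibre (poly_iter n f) p = B'"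
    if "is_block (monodromy_group (poly_iter n f) p) (fibre (poly_iter n f) p) (\<lambda>\<sigma>. \<sigma>) B'" "E \<subseteq> B'" for B'
    using block_pcompose_eq_fibre[OF assms(1) degree_poly_iter, of p "n - 1" B' a b] assms that
    unfolding n by blast
  ultimately show ?thesis
    using assms(5) unfolding is_smallest_block_def by blast
qed

end
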